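(* In the setting of the context, let $f,g:[0,T]\to\mathbb{R}$ be the solutions of $$f_t(t)=f(t)\big(\tilde\delta+l_1+2q(t)\big)-l_1-2q(t),\qquad g_t(t)=\tilde\delta g(t)+f(t)\big(l_0+p(t)-c\big)-l_0-p(t),$$ with $f(T)=0$ and $g(T)=0$. Then the expected present value of future dividends is $$V^{LQ}(t,x)=f(t)x+g(t),\qquad (t,x)\in[0,T]\times\mathbb{R}.$$
   Context: Let $T>0$, let $W$ be a Brownian motion and let $c,l_0,l_1,x_0,\varsigma,\delta,\tilde\delta,\kappa,x_T$ be real constants, $\gamma:[0,T]\to[0,\infty)$ continuous, $\Delta\Gamma(T)\ge0$, $\tau\in\{0,1,2\}$. Let $q,p:[0,T]\to\mathbb{R}$ be continuously differentiable solutions of $$q_t=\delta q+2q^2-\tfrac12\gamma+2l_1q,\qquad p_t=\delta p+\gamma x_0+2qp+l_1p+2q(l_0-c),$$ with terminal values $q(T),p(T)$ equal to the coefficients of $x^2$ and $x$ in the polynomial $\kappa(x-x_T)^\tau+\tfrac12\Delta\Gamma(T)(x-x_0)^2$. (These determine the dividend rate $l^*(t,x)=l_0+p(t)+(l_1+2q(t))x$ that is optimal for a linear-quadratic dividend problem without jumps.) The surplus under this dividend strategy has dynamics $$dX(t)=\big(c-l_0-p(t)\big)dt-\big(l_1+2q(t)\big)X(t)\,dt+\varsigma\,dW(t),$$ and the expected present value of future dividends is $$V^{LQ}(t,x)=\mathbb{E}_{t,x}\Big[\int_t^Te^{-\tilde\delta(s-t)}\Big(l_0+p(s)+\big(l_1+2q(s)\big)X(s)\Big)ds\Big],$$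 where $\mathbb{E}_{t,x}$ is expectation conditional on $X(t)=x$. Subscript $t$ on $f,g,q,p$ denotes the time derivative. *)

theory Defs
  imports "HOL-Probability.Probability" "HOL-Computational_Algebra.Polynomial"
begin

text \<open>
  All paths are required to be continuous (not merely almost all of them), so that path functionals
  such as time integrals are measurable without assuming \<open>M\<close> to be complete.
\<close>

locale brownian_motion = prob_space M for M :: "'a measure" +
  fixes W :: "real \<Rightarrow> 'a \<Rightarrow> real"
  assumes random_variable_W: "\<And>t. 0 \<le> t \<Longrightarrow> W t \<in> borel_measurable M"
    and start_W: "AE \<omega> in M. W 0 \<omega> = 0"
    and normal_increments_W:
      "\<And>s t. 0 \<le> s \<Longrightarrow> s < t \<Longrightarrow>
        distributed M lborel (\<lambda>\<omega>. W t \<omega> - W s \<omega>) (normal_density 0 (sqrt (t - s)))"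
    and indep_increments_W:
      "\<And>(u :: nat \<Rightarrow> real) n. 0 \<le> u 0 \<Longrightarrow> (\<And>i. i < n \<Longrightarrow> u i \<le> u (Suc i)) \<Longrightarrow>
        indep_vars (\<lambda>_. borel) (\<lambda>i \<omega>. W (u (Suc i)) \<omega> - W (u i) \<omega>) {..<n}"
    and continuous_paths_W: "\<And>\<omega>. \<omega> \<in> space M \<Longrightarrow> continuous_on {0..} (\<lambda>t. W t \<omega>)"

text \<open>
  Continuous solutions on \<open>{t..T}\<close> of \<open>dX(s) = b(s, X(s)) ds + \<sigma> dW(s)\<close> started from \<open>X(t) = x\<close>.
  The diffusion coefficient is constant, so the stochastic integral of \<open>\<sigma>\<close> over \<open>{t..s}\<close> is
  \<open>\<sigma> (W(s) - W(t))\<close>.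
\<close>

definition additive_sde_solution ::
  "'a measure \<Rightarrow> (real \<Rightarrow> 'a \<Rightarrow> real) \<Rightarrow> (real \<Rightarrow> real \<Rightarrow> real) \<Rightarrow> real \<Rightarrow> real \<Rightarrow> real \<Rightarrow> real \<Rightarrow>
    (real \<Rightarrow> 'a \<Rightarrow> real) \<Rightarrow> bool" where
  "additive_sde_solution M W b \<sigma> T t x X \<longleftrightarrow>
    (\<forall>s\<in>{t..T}. X s \<in> borel_measurable M) \<and>
    (\<forall>\<omega>\<in>space M. continuous_on {t..T} (\<lambda>s. X s \<omega>)) \<and>
    (AE \<omega> in M. X t \<omega> = x) \<and>
    (AE \<omega> in M. \<forall>s\<in>{t..T}.
      X s \<omega> = X t \<omega> + (LBINT u:{t..s}. b u (X u \<omega>)) + \<sigma> * (W s \<omega> - W t \<omega>))"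

definition dividend_rate ::
  "real \<Rightarrow> real \<Rightarrow> (real \<Rightarrow> real) \<Rightarrow> (real \<Rightarrow> real) \<Rightarrow> real \<Rightarrow> real \<Rightarrow> real" where
  "dividend_rate l0 l1 p q s y = l0 + p s + (l1 + 2 * q s) * y"

definition surplus_drift ::
  "real \<Rightarrow> real \<Rightarrow> real \<Rightarrow> (real \<Rightarrow> real) \<Rightarrow> (real \<Rightarrow> real) \<Rightarrow> real \<Rightarrow> real \<Rightarrow> real" where
  "surplus_drift c l0 l1 p q s y = (c - l0 - p s) - (l1 + 2 * q s) * y"

definition discounted_dividends ::
  "real \<Rightarrow> (real \<Rightarrow> real \<Rightarrow> real) \<Rightarrow> real \<Rightarrow> real \<Rightarrow> (real \<Rightarrow> 'a \<Rightarrow> real) \<Rightarrow> 'a \<Rightarrow> real" where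
  "discounted_dividends d l T t X \<omega> = (LBINT s:{t..T}. exp (- d * (s - t)) * l s (X s \<omega>))"

text \<open>
  The conditioning \<open>X(t) = x\<close> of the conditional expectation is carried by \<open>X\<close>, which is to be a
  solution started from \<open>x\<close> at time \<open>t\<close>.
\<close>

definition V_LQ ::
  "'a measure \<Rightarrow> real \<Rightarrow> real \<Rightarrow> real \<Rightarrow> (real \<Rightarrow> real) \<Rightarrow> (real \<Rightarrow> real) \<Rightarrow> real \<Rightarrow> real \<Rightarrow>
    (real \<Rightarrow> 'a \<Rightarrow> real) \<Rightarrow> real" where
  "V_LQ M d l0 l1 p q T t X =
    integral\<^sup>L M (discounted_dividends d (dividend_rate l0 l1 p q) T t X)"

definition terminal_poly :: "real \<Rightarrow> real \<Rightarrow> nat \<Rightarrow> real \<Rightarrow> real \<Rightarrow> real poly" where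
  "terminal_poly \<kappa> xT \<tau> \<Delta>\<Gamma> x0 =
    smult \<kappa> ([:- xT, 1:] ^ \<tau>) + smult (\<Delta>\<Gamma> / 2) ([:- x0, 1:] ^ 2)"

end

theory Submission
  imports Defs
begin

text \<open>
  For almost every path the discounted dividends can be computed exactly, without stochastic
  calculus. Write \<open>a = l1 + 2 q\<close> for the slope of the dividend rate and \<open>B s = W s - W t\<close> for the noise
  after time \<open>t\<close>. Since the diffusion coefficient is constant, \<open>Y = X - \<sigma> B\<close> is an ordinary \<open>C\<^sup>1\<close> function
  of time along each path. The equations for \<open>f\<close> and \<open>g\<close> are such that, up to a term linear in the
  noise, \<open>exp (- \<delta>' (s - t)) (f s * Y s + g s)\<close> is an antiderivative of minus the discounted dividend
  rate. The fundamental theorem of calculus and \<open>f T = g T = 0\<close> then give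
  (lemma \<open>discounted_feedback_integral\<close>)
  \<open>(LBINT s:{t..T}. exp (- \<delta>' (s - t)) (l0 + p s + a s * X s))
    = f t * x + g t + \<sigma> (LBINT s:{t..T}. exp (- \<delta>' (s - t)) a s (1 - f s) * B s)\<close>.
  Increments of \<open>W\<close> are centred with bounded first absolute moments, so by Fubini's theorem the noise
  integral is integrable with expectation zero (lemma \<open>weighted_noise_centred\<close>). Taking expectations
  proves the formula, and the identity passes integrability from the noise integral to the
  discounted dividends.
\<close>

section \<open>Time integrals of continuous processes\<close>

text \<open>
  Continuity in time allows \<open>Z s\<close> to be approximated by its values at grid points below \<open>s\<close>. Such an
  approximation depends on time through a countable index only, hence is jointly measurable, and
  joint measurability passes to the limit. The grid points are clamped to \<open>{a..b}\<close> because nothing is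
  known about \<open>Z\<close> outside that interval.
\<close>

lemma continuous_process_jointly_measurable:
  fixes Z :: "real \<Rightarrow> 'a \<Rightarrow> real"
  assumes "a \<le> b"
    and Z_meas: "\<And>s. s \<in> {a..b} \<Longrightarrow> Z s \<in> borel_measurable M"
    and Z_cont: "\<And>\<omega>. \<omega> \<in> space M \<Longrightarrow> continuous_on {a..b} (\<lambda>s. Z s \<omega>)"
  shows "(\<lambda>(s, \<omega>). indicator {a..b} s *\<^sub>R Z s \<omega>) \<in> borel_measurable (lborel \<Otimes>\<^sub>M M)"
proof -
  define clamp where "clamp s = max a (min b s)" for s
  define u where "u n s = real_of_int \<lfloor>real (Suc n) * s\<rfloor> / real (Suc n)" for n :: nat and s :: real
  have clamp: "clamp s \<in> {a..b}" for s
    using \<open>a \<le> b\<close> by (auto simp: clamp_def)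
  have u_lim: "(\<lambda>n. u n s) \<longlonglongrightarrow> s" for s
  proof (rule LIMSEQ_norm_0[of "\<lambda>n. u n s - s", THEN LIM_zero_cancel])
    fix n :: nat
    have "u n s - s = (\<lfloor>real (Suc n) * s\<rfloor> - real (Suc n) * s) / real (Suc n)"
      by (simp add: u_def diff_divide_distrib del: of_nat_Suc)
    moreover have "\<bar>\<lfloor>real (Suc n) * s\<rfloor> - real (Suc n) * s\<bar> < 1"
      by linarith
    ultimately show "norm (u n s - s) < 1 / real (Suc n)"
      by (simp add: abs_divide divide_strict_right_mono del: of_nat_Suc)
  qed
  have "(\<lambda>z. Z (clamp (u n (fst z))) (snd z)) \<in> borel_measurable (lborel \<Otimes>\<^sub>M M)" for n
    unfolding u_def
  proof (rule measurable_compose_countable[where g="\<lambda>z. \<lfloor>real (Suc n) * fst z\<rfloor>"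
        and f="\<lambda>i z. Z (clamp (real_of_int i / real (Suc n))) (snd z)"])
    show "(\<lambda>z. Z (clamp (real_of_int i / real (Suc n))) (snd z)) \<in> borel_measurable (lborel \<Otimes>\<^sub>M M)" for i
      by (rule measurable_compose[OF measurable_snd Z_meas[OF clamp]])
    show "(\<lambda>z. \<lfloor>real (Suc n) * fst z\<rfloor>) \<in> lborel \<Otimes>\<^sub>M M \<rightarrow>\<^sub>M count_space UNIV"
      by measurable
  qed
  then have "(\<lambda>z. Z (clamp (fst z)) (snd z)) \<in> borel_measurable (lborel \<Otimes>\<^sub>M M)"
  proof (rule borel_measurable_LIMSEQ_real[rotated])
    fix z :: "real \<times> 'a" assume "z \<in> space (lborel \<Otimes>\<^sub>M M)"
    then have "snd z \<in> space M" by (auto simp: space_pair_measure)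
    moreover have "(\<lambda>n. clamp (u n (fst z))) \<longlonglongrightarrow> clamp (fst z)"
      unfolding clamp_def by (intro tendsto_intros u_lim)
    ultimately show "(\<lambda>n. Z (clamp (u n (fst z))) (snd z)) \<longlonglongrightarrow> Z (clamp (fst z)) (snd z)"
      using clamp by (intro continuous_on_tendsto_compose[OF Z_cont]) auto
  qed
  then have "(\<lambda>z. indicator {a..b} (fst z) *\<^sub>R Z (clamp (fst z)) (snd z))
      \<in> borel_measurable (lborel \<Otimes>\<^sub>M M)"
    by measurable
  moreover have "indicator {a..b} s *\<^sub>R Z (clamp s) \<omega> = indicator {a..b} s *\<^sub>R Z s \<omega>" for s \<omega>
    by (auto simp: clamp_def min_absorb2 max_absorb2 split: split_indicator)
  ultimately show ?thesis
    by (simp only: case_prod_beta')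
qed

lemma time_integral_measurable:
  fixes Z :: "real \<Rightarrow> 'a \<Rightarrow> real"
  assumes "a \<le> b"
    and "\<And>s. s \<in> {a..b} \<Longrightarrow> Z s \<in> borel_measurable M"
    and "\<And>\<omega>. \<omega> \<in> space M \<Longrightarrow> continuous_on {a..b} (\<lambda>s. Z s \<omega>)"
  shows "(\<lambda>\<omega>. LBINT s:{a..b}. Z s \<omega>) \<in> borel_measurable M"
  unfolding set_lebesgue_integral_def
  by (rule lborel.borel_measurable_lebesgue_integral)
    (use measurable_pair_swap[OF continuous_process_jointly_measurable[OF assms]] in
      \<open>simp add: case_prod_beta\<close>)

text \<open>
  The bound \<open>C\<close> on the absolute moments, uniform in time over a bounded interval, makes the process
  integrable over the product space, which is what Fubini's theorem requires.
\<close>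

lemma (in sigma_finite_measure) Fubini_time_integral:
  fixes Z :: "real \<Rightarrow> 'a \<Rightarrow> real"
  assumes "a \<le> b"
    and Z_int: "\<And>s. s \<in> {a..b} \<Longrightarrow> integrable M (Z s)"
    and Z_bound: "\<And>s. s \<in> {a..b} \<Longrightarrow> (\<integral>\<omega>. \<bar>Z s \<omega>\<bar> \<partial>M) \<le> C"
    and Z_cont: "\<And>\<omega>. \<omega> \<in> space M \<Longrightarrow> continuous_on {a..b} (\<lambda>s. Z s \<omega>)"
  shows "integrable M (\<lambda>\<omega>. LBINT s:{a..b}. Z s \<omega>)"
    and "(\<integral>\<omega>. (LBINT s:{a..b}. Z s \<omega>) \<partial>M) = (LBINT s:{a..b}. \<integral>\<omega>. Z s \<omega> \<partial>M)"
proof -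
  interpret P: pair_sigma_finite lborel M ..
  let ?Z = "\<lambda>(s, \<omega>). indicator {a..b} s *\<^sub>R Z s \<omega>"
  have meas [measurable]: "?Z \<in> borel_measurable (lborel \<Otimes>\<^sub>M M)"
    using assms by (intro continuous_process_jointly_measurable) auto
  have "integrable (lborel \<Otimes>\<^sub>M M) ?Z"
  proof (rule P.Fubini_integrable)
    show "integrable lborel (\<lambda>s. \<integral>\<omega>. norm (?Z (s, \<omega>)) \<partial>M)"
    proof (rule Bochner_Integration.integrable_bound[where f="\<lambda>s. indicator {a..b} s *\<^sub>R C"])
      show "AE s in lborel. norm (\<integral>\<omega>. norm (?Z (s, \<omega>)) \<partial>M) \<le> norm (indicator {a..b} s *\<^sub>R C)"
      proof (rule AE_I2)
        fix s
        show "norm (\<integral>\<omega>. norm (?Z (s, \<omega>)) \<partial>M) \<le> norm (indicator {a..b} s *\<^sub>R C)"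
        proof (cases "s \<in> {a..b}")
          case True
          have "0 \<le> (\<integral>\<omega>. \<bar>Z s \<omega>\<bar> \<partial>M)" by simp
          with Z_bound[OF True] True show ?thesis by simp
        qed simp
      qed
      show "(\<lambda>s. \<integral>\<omega>. norm (?Z (s, \<omega>)) \<partial>M) \<in> borel_measurable lborel"
        using meas by (intro borel_measurable_lebesgue_integral) (simp add: case_prod_beta)
      show "integrable lborel (\<lambda>s. indicator {a..b} s *\<^sub>R C)"
        using \<open>a \<le> b\<close> by (intro integrable_scaleR_left integrable_real_indicator) auto
    qed
    show "AE s in lborel. integrable M (\<lambda>\<omega>. ?Z (s, \<omega>))"
      using Z_int by (auto split: split_indicator)
  qed fact
  then show "integrable M (\<lambda>\<omega>. LBINT s:{a..b}. Z s \<omega>)"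
    and "(\<integral>\<omega>. (LBINT s:{a..b}. Z s \<omega>) \<partial>M) = (LBINT s:{a..b}. \<integral>\<omega>. Z s \<omega> \<partial>M)"
    using P.integrable_snd[of "\<lambda>s \<omega>. ?Z (s, \<omega>)"] P.Fubini_integral[of "\<lambda>s \<omega>. ?Z (s, \<omega>)"]
    by (simp_all add: set_lebesgue_integral_def)
qed

section \<open>Centred Brownian noise\<close>

lemma (in brownian_motion) increment_moments:
  assumes "0 \<le> s" "s \<le> t"
  shows "integrable M (\<lambda>\<omega>. W t \<omega> - W s \<omega>)"
    and "expectation (\<lambda>\<omega>. W t \<omega> - W s \<omega>) = 0"
    and "expectation (\<lambda>\<omega>. \<bar>W t \<omega> - W s \<omega>\<bar>) = sqrt (t - s) * sqrt (2 / pi)"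
proof -
  have "integrable M (\<lambda>\<omega>. W t \<omega> - W s \<omega>) \<and> expectation (\<lambda>\<omega>. W t \<omega> - W s \<omega>) = 0 \<and>
    expectation (\<lambda>\<omega>. \<bar>W t \<omega> - W s \<omega>\<bar>) = sqrt (t - s) * sqrt (2 / pi)"
  proof (cases "s = t")
    case False
    \<comment> \<open>The odd absolute moment of order \<open>2 * k + 1\<close> with \<open>k = 0\<close> is the first one.\<close>
    then have pos: "0 < sqrt (t - s)" and st: "s < t" using assms by auto
    note D = normal_increments_W[OF assms(1) st]
    show ?thesis
      using distributed_integrable[OF D, of "\<lambda>x. x"] integrable_normal_moment_nz_1[OF pos, of 0]
        normal_distributed_expectation[OF pos D]
        distributed_integral[OF D, of abs] integral_normal_moment_abs_odd[OF pos, of 0 0]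
      by simp
  qed simp
  then show "integrable M (\<lambda>\<omega>. W t \<omega> - W s \<omega>)"
    and "expectation (\<lambda>\<omega>. W t \<omega> - W s \<omega>) = 0"
    and "expectation (\<lambda>\<omega>. \<bar>W t \<omega> - W s \<omega>\<bar>) = sqrt (t - s) * sqrt (2 / pi)"
    by auto
qed

lemma (in brownian_motion) weighted_noise_centred:
  assumes "0 \<le> t" "t \<le> T" and h: "continuous_on {t..T} h"
  shows "integrable M (\<lambda>\<omega>. LBINT s:{t..T}. h s * (W s \<omega> - W t \<omega>))"
    and "expectation (\<lambda>\<omega>. LBINT s:{t..T}. h s * (W s \<omega> - W t \<omega>)) = 0"
proof -
  obtain H where H: "\<And>s. s \<in> {t..T} \<Longrightarrow> \<bar>h s\<bar> \<le> H"
    using compact_imp_bounded[OF compact_continuous_image[OF h compact_Icc]]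
    by (force simp: bounded_iff)
  then have "0 \<le> H" using \<open>t \<le> T\<close> by (meson abs_ge_zero atLeastAtMost_iff order_refl order_trans)
  have int: "integrable M (\<lambda>\<omega>. h s * (W s \<omega> - W t \<omega>))" if "s \<in> {t..T}" for s
    using increment_moments(1)[of t s] that \<open>0 \<le> t\<close> by auto
  have bound: "expectation (\<lambda>\<omega>. \<bar>h s * (W s \<omega> - W t \<omega>)\<bar>) \<le> H * (sqrt (T - t) * sqrt (2 / pi))"
    if "s \<in> {t..T}" for s
    using increment_moments(3)[of t s] that \<open>0 \<le> t\<close> H[OF that] \<open>0 \<le> H\<close>
    by (auto simp: abs_mult intro!: mult_mono)
  have cont: "continuous_on {t..T} (\<lambda>s. h s * (W s \<omega> - W t \<omega>))" if "\<omega> \<in> space M" for \<omega>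
    by (intro continuous_intros h continuous_on_subset[OF continuous_paths_W[OF that]])
      (use \<open>0 \<le> t\<close> in auto)
  note fubini = Fubini_time_integral[OF \<open>t \<le> T\<close> int bound cont]
  show "integrable M (\<lambda>\<omega>. LBINT s:{t..T}. h s * (W s \<omega> - W t \<omega>))"
    by (rule fubini(1))
  have "expectation (\<lambda>\<omega>. h s * (W s \<omega> - W t \<omega>)) = 0" if "s \<in> {t..T}" for s
    using increment_moments(2)[of t s] that \<open>0 \<le> t\<close> by auto
  then have "(LBINT s:{t..T}. expectation (\<lambda>\<omega>. h s * (W s \<omega> - W t \<omega>))) = (LBINT s:{t..T}. 0)"
    by (intro set_lebesgue_integral_cong) auto
  then show "expectation (\<lambda>\<omega>. LBINT s:{t..T}. h s * (W s \<omega> - W t \<omega>)) = 0"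
    by (subst fubini(2)) auto
qed

section \<open>The pathwise representation\<close>

text \<open>
  This identity is deterministic: \<open>X\<close> and \<open>B\<close> stand for a single path of the surplus and of the noise.
  The path \<open>B\<close> is only continuous, so \<open>X\<close> cannot be differentiated; the product rule is applied to
  \<open>Y = X - \<sigma> B\<close>, whose derivative is the drift. In the derivative of \<open>exp (- d (s - t)) (f Y + g)\<close>
  the contributions of \<open>k\<close> and of the discount cancel; what remains of the state is \<open>- a Y - f a \<sigma> B\<close>,
  that is \<open>- a X + \<sigma> a (1 - f) B\<close>.
\<close>

lemma discounted_feedback_integral:
  fixes X B a k m f g :: "real \<Rightarrow> real"
  assumes "t \<le> T"
    and cont: "continuous_on {t..T} X" "continuous_on {t..T} B" "continuous_on {t..T} a"
      "continuous_on {t..T} k" "continuous_on {t..T} m"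
    and X: "\<And>s. s \<in> {t..T} \<Longrightarrow> X s = x + (LBINT u:{t..s}. k u - a u * X u) + \<sigma> * B s"
    and f: "\<And>s. s \<in> {t..T} \<Longrightarrow>
      (f has_real_derivative (f s * (d + a s) - a s)) (at s within {t..T})"
    and g: "\<And>s. s \<in> {t..T} \<Longrightarrow>
      (g has_real_derivative (d * g s - f s * k s - m s)) (at s within {t..T})"
    and "f T = 0" "g T = 0"
  shows "(LBINT s:{t..T}. exp (- d * (s - t)) * (m s + a s * X s)) =
    f t * x + g t + \<sigma> * (LBINT s:{t..T}. (exp (- d * (s - t)) * a s * (1 - f s)) * B s)"
proof -
  define E where "E s = exp (- d * (s - t))" for s
  define Y where "Y s = X s - \<sigma> * B s" for s
  have f_cont: "continuous_on {t..T} f"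
    by (rule DERIV_continuous_on[OF f])
  have E_cont: "continuous_on {t..T} E"
    unfolding E_def by (intro continuous_intros)
  have E: "(E has_real_derivative (- d * E s)) (at s within {t..T})" for s
    unfolding E_def by (auto intro!: derivative_eq_intros)
  have drift_cont: "continuous_on {t..T} (\<lambda>u. k u - a u * X u)"
    by (intro continuous_intros cont)
  have Y_eq: "Y s = x + integral {t..s} (\<lambda>u. k u - a u * X u)" if "s \<in> {t..T}" for s
  proof -
    have "set_integrable lborel {t..s} (\<lambda>u. k u - a u * X u)"
      using that by (intro borel_integrable_atLeastAtMost' continuous_on_subset[OF drift_cont]) auto
    from set_borel_integral_eq_integral(2)[OF this] show ?thesis
      using X[OF that] by (simp add: Y_def)
  qed
  have Y: "(Y has_real_derivative (k s - a s * X s)) (at s within {t..T})" if "s \<in> {t..T}" for s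
    unfolding has_real_derivative_iff_has_vector_derivative
  proof (rule has_vector_derivative_transform[OF that])
    show "((\<lambda>s. x + integral {t..s} (\<lambda>u. k u - a u * X u)) has_vector_derivative (k s - a s * X s))
        (at s within {t..T})"
      using has_vector_derivative_add[OF has_vector_derivative_const
          integral_has_vector_derivative[OF drift_cont that]]
      by simp
  qed (simp add: Y_eq)
  define noise where "noise s = (E s * a s * (1 - f s)) * B s" for s
  define payout where "payout s = E s * (m s + a s * X s)" for s
  have noise: "set_integrable lborel {t..T} noise" and payout: "set_integrable lborel {t..T} payout"
    unfolding noise_def payout_def
    by (intro borel_integrable_atLeastAtMost' continuous_intros cont f_cont E_cont)+
  have "((\<lambda>s. E s * (f s * Y s + g s)) has_real_derivative (\<sigma> * noise s - payout s))
      (at s within {t..T})" if "s \<in> {t..T}" for s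
    by (rule derivative_eq_intros E f g Y that refl)+
      (simp add: noise_def payout_def Y_def algebra_simps)
  then have "(LBINT s:{t..T}. \<sigma> * noise s - payout s) =
      E T * (f T * Y T + g T) - E t * (f t * Y t + g t)"
    unfolding set_lebesgue_integral_def
    by (intro integral_FTC_atLeastAtMost \<open>t \<le> T\<close>)
      (auto simp: has_real_derivative_iff_has_vector_derivative noise_def payout_def
        intro!: continuous_intros cont f_cont E_cont)
  also have "\<dots> = - (f t * x + g t)"
    using \<open>t \<le> T\<close> \<open>f T = 0\<close> \<open>g T = 0\<close> by (simp add: Y_eq E_def)
  finally have "\<sigma> * (LBINT s:{t..T}. noise s) - (LBINT s:{t..T}. payout s) = - (f t * x + g t)"
    using noise payout by (simp add: set_integral_diff)
  then show ?thesis
    by (simp add: noise_def payout_def E_def)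
qed

section \<open>The expected present value\<close>

theorem mainTheorem8:
  fixes M :: "'a measure" and W :: "real \<Rightarrow> 'a \<Rightarrow> real"
    and T c l0 l1 x0 \<sigma> \<delta> \<delta>' \<kappa> xT \<Delta>\<Gamma> :: real
    and \<tau> :: nat
    and \<gamma> q p f g :: "real \<Rightarrow> real"
  assumes "T > 0"
    and "brownian_motion M W"
    and "continuous_on {0..T} \<gamma>" and "\<And>t. t \<in> {0..T} \<Longrightarrow> \<gamma> t \<ge> 0"
    and "\<Delta>\<Gamma> \<ge> 0" and "\<tau> \<in> {0, 1, 2}"
    and "\<And>t. t \<in> {0..T} \<Longrightarrow>
      (q has_real_derivative (\<delta> * q t + 2 * (q t)\<^sup>2 - 1 / 2 * \<gamma> t + 2 * l1 * q t))
        (at t within {0..T})"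
    and "\<And>t. t \<in> {0..T} \<Longrightarrow>
      (p has_real_derivative
        (\<delta> * p t + \<gamma> t * x0 + 2 * q t * p t + l1 * p t + 2 * q t * (l0 - c)))
        (at t within {0..T})"
    and "q T = coeff (terminal_poly \<kappa> xT \<tau> \<Delta>\<Gamma> x0) 2"
    and "p T = coeff (terminal_poly \<kappa> xT \<tau> \<Delta>\<Gamma> x0) 1"
    and "\<And>t. t \<in> {0..T} \<Longrightarrow>
      (f has_real_derivative (f t * (\<delta>' + l1 + 2 * q t) - l1 - 2 * q t)) (at t within {0..T})"
    and "\<And>t. t \<in> {0..T} \<Longrightarrow>
      (g has_real_derivative (\<delta>' * g t + f t * (l0 + p t - c) - l0 - p t)) (at t within {0..T})"
    and "f T = 0" and "g T = 0"
  shows "\<forall>t\<in>{0..T}. \<forall>x X.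
    additive_sde_solution M W (surplus_drift c l0 l1 p q) \<sigma> T t x X \<longrightarrow>
      integrable M (discounted_dividends \<delta>' (dividend_rate l0 l1 p q) T t X) \<and>
      V_LQ M \<delta>' l0 l1 p q T t X = f t * x + g t"
proof (intro ballI allI impI)
  fix t x X
  assume t: "t \<in> {0..T}"
    and sol: "additive_sde_solution M W (surplus_drift c l0 l1 p q) \<sigma> T t x X"
  interpret brownian_motion M W by fact
  let ?D = "discounted_dividends \<delta>' (dividend_rate l0 l1 p q) T t X"
  let ?h = "\<lambda>s. exp (- \<delta>' * (s - t)) * (l1 + 2 * q s) * (1 - f s)"
  let ?N = "\<lambda>\<omega>. LBINT s:{t..T}. ?h s * (W s \<omega> - W t \<omega>)"
  have tT: "0 \<le> t" "t \<le> T" "{t..T} \<subseteq> {0..T}" using t by auto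
  have X_meas: "\<And>s. s \<in> {t..T} \<Longrightarrow> X s \<in> borel_measurable M"
    and X_cont: "\<And>\<omega>. \<omega> \<in> space M \<Longrightarrow> continuous_on {t..T} (\<lambda>s. X s \<omega>)"
    and X_start: "AE \<omega> in M. X t \<omega> = x"
    and X_eq: "AE \<omega> in M. \<forall>s\<in>{t..T}. X s \<omega> = X t \<omega> +
      (LBINT u:{t..s}. surplus_drift c l0 l1 p q u (X u \<omega>)) + \<sigma> * (W s \<omega> - W t \<omega>)"
    using sol by (auto simp: additive_sde_solution_def)
  have q_cont: "continuous_on {t..T} q" and p_cont: "continuous_on {t..T} p"
    and f_cont: "continuous_on {t..T} f"
    by (rule continuous_on_subset[OF DERIV_continuous_on tT(3)], erule assms(7,8,11))+
  have h_cont: "continuous_on {t..T} ?h"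
    by (intro continuous_intros q_cont f_cont)
  note N = weighted_noise_centred[OF tT(1,2) h_cont]
  have D_eq: "AE \<omega> in M. ?D \<omega> = f t * x + g t + \<sigma> * ?N \<omega>"
    using X_start X_eq AE_space
  proof eventually_elim
    case (elim \<omega>)
    show ?case
      unfolding discounted_dividends_def dividend_rate_def
    proof (rule discounted_feedback_integral[where k="\<lambda>s. c - l0 - p s" and d=\<delta>'])
      show "continuous_on {t..T} (\<lambda>s. W s \<omega> - W t \<omega>)"
        by (intro continuous_intros continuous_on_subset[OF continuous_paths_W[OF elim(3)]])
          (use tT in auto)
      show "X s \<omega> = x + (LBINT u:{t..s}. c - l0 - p u - (l1 + 2 * q u) * X u \<omega>) +
          \<sigma> * (W s \<omega> - W t \<omega>)" if "s \<in> {t..T}" for s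
        using elim that by (auto simp: surplus_drift_def)
      show "(f has_real_derivative f s * (\<delta>' + (l1 + 2 * q s)) - (l1 + 2 * q s))
          (at s within {t..T})" if "s \<in> {t..T}" for s
        using DERIV_subset[OF assms(11) tT(3)] that tT by (auto simp: algebra_simps)
      show "(g has_real_derivative \<delta>' * g s - f s * (c - l0 - p s) - (l0 + p s))
          (at s within {t..T})" if "s \<in> {t..T}" for s
        using DERIV_subset[OF assms(12) tT(3)] that tT by (auto simp: algebra_simps)
    qed (use tT assms X_cont[OF elim(3)] in \<open>auto intro!: continuous_intros q_cont p_cont\<close>)
  qed
  \<comment> \<open>The almost sure identity does not settle measurability of the left side, since \<open>M\<close> may be
    incomplete; it comes from the continuity of all paths of \<open>X\<close>.\<close>
  have D_meas: "?D \<in> borel_measurable M"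
    unfolding discounted_dividends_def dividend_rate_def
    by (intro time_integral_measurable tT(2) continuous_intros p_cont q_cont X_cont)
      (use X_meas in measurable)
  have "integrable M ?D \<longleftrightarrow> integrable M (\<lambda>\<omega>. f t * x + g t + \<sigma> * ?N \<omega>)"
    using D_eq D_meas N(1) by (intro integrable_cong_AE) auto
  then have "integrable M ?D" using N(1) by simp
  moreover have "integral\<^sup>L M ?D = expectation (\<lambda>\<omega>. f t * x + g t + \<sigma> * ?N \<omega>)"
    using D_eq D_meas N(1) by (intro integral_cong_AE) auto
  then have "integral\<^sup>L M ?D = f t * x + g t"
    using N by (simp add: prob_space)
  ultimately show "integrable M ?D \<and> V_LQ M \<delta>' l0 l1 p q T t X = f t * x + g t"
    by (simp add: V_LQ_def)
qed

end
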